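(* Let $\Theta$ be a variety of one-sorted algebras with signature $\Omega$, let $\Phi$ be a strongly stable automorphism of the category $\Theta^0$, let $S=\{s^\Phi_B:B\to B\mid B\in\mathrm{Ob}\,\Theta^0\}$ be a system of bijections with which $\Phi$ fulfills conditions A2) and A3), and let $w_\omega(x)=s^\Phi_{A_\omega}(\omega(x))\in A_\omega$ for $\omega\in\Omega$. For $H\in\Theta$ let $H^{*}$ be the algebra with the same domain as $H$ and with operations $\omega^{*}_H$ ($\omega\in\Omega$) induced on $H$ by the words $w_\omega(x)$. Then for every $H\in\Theta$ the automorphism $\Phi^{-1}$ provides the automorphic equivalence of the algebras $H$ and $H^{*}$ in the variety $\Theta$.
   Context: Category $\Theta^0$. Let $X_0=\{x_1,x_2,\ldots,x_n,\ldots\}$ be a countable set of symbols. $\Theta^0$ is the category whose objects are the free algebras $W(X)$ of the variety $\Theta$ generated by the finite subsets $X\subset X_0$, and whose morphisms are all homomorphisms between these algebras. Strongly stable automorphisms. An automorphism $\Phi$ of $\Theta^0$ is strongly stable if: A1) $\Phi$ preserves all objects of $\Theta^0$; A2) there exists a system of bijections $\{s^\Phi_B:B\to B\mid B\in\mathrm{Ob}\,\Theta^0\}$ such that $\Phi(\alpha)=s^\Phi_B\,\alpha\,(s^\Phi_A)^{-1}$ for every $\alpha\in\mathrm{Hom}(A,B)$, $A,B\in\mathrm{Ob}\,\Theta^0$; A3) $s^\Phi_B|_X=\mathrm{id}_X$ for every $B=W(X)\in\mathrm{Ob}\,\Theta^0$. Words and verbal operations. For $\omega\in\Omega$ of arity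 $k$ put $X_\omega=\{x_1,\ldots,x_k\}\subset X_0$, $A_\omega=W(X_\omega)$ and $\omega(x)=\omega(x_1,\ldots,x_k)\in A_\omega$. A word $w\in W(\{x_1,\ldots,x_k\})$ induces on every $H\in\Theta$ the $k$-ary verbal operation $(h_1,\ldots,h_k)\mapsto\gamma_h(w)$, where $\gamma_h:W(\{x_1,\ldots,x_k\})\to H$ is the homomorphism with $\gamma_h(x_i)=h_i$, $1\le i\le k$. The operation induced on $H$ by $w_\omega$ is denoted $\omega^{*}_H$; $H^{*}$ is an algebra of signature $\Omega$ in which $\omega$ is realized by $\omega^{*}_H$. (It is a fact that $H^{*}\in\Theta$.) Closed congruences. Let $H\in\Theta$, $B\in\mathrm{Ob}\,\Theta^0$. For $T\subset B^2$ put $T'_H=\{\mu\in\mathrm{Hom}(B,H)\mid T\subset\ker\mu\}$, and for $R\subset\mathrm{Hom}(B,H)$ put $R'_H=\bigcap_{\mu\in R}\ker\mu$. $T\subset B^2$ is $H$-closed if $T=T''_H=(T'_H)'_H$; an $H$-closed set is a congruence on $B$. $Cl_H(B)$ denotes the set of all $H$-closed congruences on $B$. Automorphic equivalence. An automorphism $\Psi:\Theta^0\to\Theta^0$ provides the automorphic equivalence of $H_1,H_2\in\Theta$ if for every $B\in\mathrm{Ob}\,\Theta^0$ there is a bijection $\alpha(\Psi)_B:Cl_{H_1}(B)\to Cl_{H_2}(\Psi(B))$ such that for all $B_1,B_2\in\mathrm{Ob}\,\Theta^0$, all $\mu_1,\mu_2\in\mathrm{Hom}(B_1,B_2)$ and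 all $T\in Cl_{H_1}(B_2)$: $\tau\mu_1=\tau\mu_2$ if and only if $\widetilde\tau\,\Psi(\mu_1)=\widetilde\tau\,\Psi(\mu_2)$, where $\tau:B_2\to B_2/T$ and $\widetilde\tau:\Psi(B_2)\to\Psi(B_2)/\alpha(\Psi)_{B_2}(T)$ are the natural epimorphisms. *)

theory Defs
  imports Main "HOL-Library.FuncSet"
begin

(* The countable set X_0 = {x_1, x_2, ...} is represented by nat, the number i standing for x_{i+1};
   thus {x_1, ..., x_k} is {..<k}. *)

datatype 'f trm = Var nat | App 'f "'f trm list"

(* A variety is given by its signature and a set of identities.  The signature is a set of symbols
   rather than the whole type 'f, so that it may be empty. *)
record 'f var_data =
  symbols :: "'f set"
  arity :: "'f \<Rightarrow> nat"
  identities :: "('f trm \<times> 'f trm) set"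

(* Empty carriers are permitted (when there are no nullary operations). *)
record ('f, 'a) algebra =
  carrier :: "'a set"
  operation :: "'f \<Rightarrow> 'a list \<Rightarrow> 'a"

inductive_set terms :: "'f var_data \<Rightarrow> nat set \<Rightarrow> 'f trm set"
  for \<Theta> :: "'f var_data" and X :: "nat set" where
  Var: "x \<in> X \<Longrightarrow> Var x \<in> terms \<Theta> X"
| App: "\<lbrakk>f \<in> symbols \<Theta>; length ts = arity \<Theta> f; \<forall>t\<in>set ts. t \<in> terms \<Theta> X\<rbrakk>
    \<Longrightarrow> App f ts \<in> terms \<Theta> X"

definition variety :: "'f var_data \<Rightarrow> bool" where
  "variety \<Theta> \<longleftrightarrow> identities \<Theta> \<subseteq> terms \<Theta> UNIV \<times> terms \<Theta> UNIV"

primrec eval :: "('f, 'a) algebra \<Rightarrow> (nat \<Rightarrow> 'a) \<Rightarrow> 'f trm \<Rightarrow> 'a" where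
  "eval H h (Var x) = h x"
| "eval H h (App f ts) = operation H f (map (eval H h) ts)"

primrec subst :: "(nat \<Rightarrow> 'f trm) \<Rightarrow> 'f trm \<Rightarrow> 'f trm" where
  "subst \<sigma> (Var x) = \<sigma> x"
| "subst \<sigma> (App f ts) = App f (map (subst \<sigma>) ts)"

definition is_algebra :: "'f var_data \<Rightarrow> ('f, 'a) algebra \<Rightarrow> bool" where
  "is_algebra \<Theta> H \<longleftrightarrow> (\<forall>f\<in>symbols \<Theta>. \<forall>as. length as = arity \<Theta> f \<and> set as \<subseteq> carrier H
     \<longrightarrow> operation H f as \<in> carrier H)"

definition in_variety :: "'f var_data \<Rightarrow> ('f, 'a) algebra \<Rightarrow> bool" where
  "in_variety \<Theta> H \<longleftrightarrow> is_algebra \<Theta> H \<and>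
     (\<forall>(u, v)\<in>identities \<Theta>. \<forall>h. (\<forall>x. h x \<in> carrier H) \<longrightarrow> eval H h u = eval H h v)"

(* A homomorphism is a map on the carrier of A, hence extensional (undefined elsewhere). *)
definition homs :: "'f var_data \<Rightarrow> ('f, 'a) algebra \<Rightarrow> ('f, 'b) algebra \<Rightarrow> ('a \<Rightarrow> 'b) set" where
  "homs \<Theta> A B = {\<alpha> \<in> carrier A \<rightarrow>\<^sub>E carrier B.
     \<forall>f\<in>symbols \<Theta>. \<forall>as. length as = arity \<Theta> f \<and> set as \<subseteq> carrier A
       \<longrightarrow> \<alpha> (operation A f as) = operation B f (map \<alpha> as)}"

(* The least congruence on the term algebra over X containing all substitution instances
   of the identities of the variety. *)
inductive_set free_cong :: "'f var_data \<Rightarrow> nat set \<Rightarrow> ('f trm \<times> 'f trm) set"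
  for \<Theta> :: "'f var_data" and X :: "nat set" where
  inst: "\<lbrakk>(u, v) \<in> identities \<Theta>; \<forall>x. \<sigma> x \<in> terms \<Theta> X\<rbrakk>
    \<Longrightarrow> (subst \<sigma> u, subst \<sigma> v) \<in> free_cong \<Theta> X"
| refl: "t \<in> terms \<Theta> X \<Longrightarrow> (t, t) \<in> free_cong \<Theta> X"
| sym: "(s, t) \<in> free_cong \<Theta> X \<Longrightarrow> (t, s) \<in> free_cong \<Theta> X"
| trans: "\<lbrakk>(s, t) \<in> free_cong \<Theta> X; (t, u) \<in> free_cong \<Theta> X\<rbrakk> \<Longrightarrow> (s, u) \<in> free_cong \<Theta> X"
| cong: "\<lbrakk>f \<in> symbols \<Theta>; length ss = arity \<Theta> f; length ts = arity \<Theta> f;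
     \<forall>i<arity \<Theta> f. (ss ! i, ts ! i) \<in> free_cong \<Theta> X\<rbrakk>
    \<Longrightarrow> (App f ss, App f ts) \<in> free_cong \<Theta> X"

(* The free algebra W(X): the quotient of the term algebra over X by free_cong.  An operation sends
   classes as to the class of App f ts for any representatives ts. *)
definition W :: "'f var_data \<Rightarrow> nat set \<Rightarrow> ('f, 'f trm set) algebra" where
  "W \<Theta> X = \<lparr>carrier = terms \<Theta> X // free_cong \<Theta> X,
     operation = (\<lambda>f as. {t. \<exists>ts. list_all2 (\<in>) ts as \<and> (App f ts, t) \<in> free_cong \<Theta> X})\<rparr>"

definition gen :: "'f var_data \<Rightarrow> nat set \<Rightarrow> nat \<Rightarrow> 'f trm set" where
  "gen \<Theta> X x = free_cong \<Theta> X `` {Var x}"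

(* Different X give different W(X) (the union of the classes is the set of terms over X), so the
   objects of Theta^0 are the algebras themselves. *)
definition Ob :: "'f var_data \<Rightarrow> ('f, 'f trm set) algebra set" where
  "Ob \<Theta> = {W \<Theta> X | X. finite X}"

(* arr_map F A B is the action of F on Hom(A, B); the (co)domain is passed explicitly because an
   extensional function does not determine its codomain. *)
record 'f endofunctor =
  obj_map :: "('f, 'f trm set) algebra \<Rightarrow> ('f, 'f trm set) algebra"
  arr_map :: "('f, 'f trm set) algebra \<Rightarrow> ('f, 'f trm set) algebra
    \<Rightarrow> ('f trm set \<Rightarrow> 'f trm set) \<Rightarrow> ('f trm set \<Rightarrow> 'f trm set)"

definition automorphism :: "'f var_data \<Rightarrow> 'f endofunctor \<Rightarrow> bool" where
  "automorphism \<Theta> \<Phi> \<longleftrightarrow>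
     bij_betw (obj_map \<Phi>) (Ob \<Theta>) (Ob \<Theta>) \<and>
     (\<forall>A\<in>Ob \<Theta>. \<forall>B\<in>Ob \<Theta>.
        bij_betw (arr_map \<Phi> A B) (homs \<Theta> A B) (homs \<Theta> (obj_map \<Phi> A) (obj_map \<Phi> B))) \<and>
     (\<forall>A\<in>Ob \<Theta>. arr_map \<Phi> A A (\<lambda>x\<in>carrier A. x) = (\<lambda>x\<in>carrier (obj_map \<Phi> A). x)) \<and>
     (\<forall>A\<in>Ob \<Theta>. \<forall>B\<in>Ob \<Theta>. \<forall>C\<in>Ob \<Theta>. \<forall>\<alpha>\<in>homs \<Theta> A B. \<forall>\<beta>\<in>homs \<Theta> B C.
        arr_map \<Phi> A C (compose (carrier A) \<beta> \<alpha>) =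
          compose (carrier (obj_map \<Phi> A)) (arr_map \<Phi> B C \<beta>) (arr_map \<Phi> A B \<alpha>))"

definition inv_functor :: "'f var_data \<Rightarrow> 'f endofunctor \<Rightarrow> 'f endofunctor" where
  "inv_functor \<Theta> \<Phi> =
     \<lparr>obj_map = inv_into (Ob \<Theta>) (obj_map \<Phi>),
      arr_map = (\<lambda>A B.
        let A' = inv_into (Ob \<Theta>) (obj_map \<Phi>) A; B' = inv_into (Ob \<Theta>) (obj_map \<Phi>) B
        in inv_into (homs \<Theta> A' B') (arr_map \<Phi> A' B'))\<rparr>"

definition A1 :: "'f var_data \<Rightarrow> 'f endofunctor \<Rightarrow> bool" where
  "A1 \<Theta> \<Phi> \<longleftrightarrow> (\<forall>A\<in>Ob \<Theta>. obj_map \<Phi> A = A)"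

definition A2 :: "'f var_data \<Rightarrow> 'f endofunctor
    \<Rightarrow> (('f, 'f trm set) algebra \<Rightarrow> 'f trm set \<Rightarrow> 'f trm set) \<Rightarrow> bool" where
  "A2 \<Theta> \<Phi> s \<longleftrightarrow>
     (\<forall>B\<in>Ob \<Theta>. bij_betw (s B) (carrier B) (carrier B)) \<and>
     (\<forall>A\<in>Ob \<Theta>. \<forall>B\<in>Ob \<Theta>. \<forall>\<alpha>\<in>homs \<Theta> A B.
        arr_map \<Phi> A B \<alpha> = (\<lambda>a\<in>carrier A. s B (\<alpha> (inv_into (carrier A) (s A) a))))"

definition A3 :: "'f var_data
    \<Rightarrow> (('f, 'f trm set) algebra \<Rightarrow> 'f trm set \<Rightarrow> 'f trm set) \<Rightarrow> bool" where
  "A3 \<Theta> s \<longleftrightarrow> (\<forall>X. finite X \<longrightarrow> (\<forall>x\<in>X. s (W \<Theta> X) (gen \<Theta> X x) = gen \<Theta> X x))"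

definition strongly_stable :: "'f var_data \<Rightarrow> 'f endofunctor \<Rightarrow> bool" where
  "strongly_stable \<Theta> \<Phi> \<longleftrightarrow> automorphism \<Theta> \<Phi> \<and> A1 \<Theta> \<Phi> \<and> (\<exists>s. A2 \<Theta> \<Phi> s \<and> A3 \<Theta> s)"

definition A_omega :: "'f var_data \<Rightarrow> 'f \<Rightarrow> ('f, 'f trm set) algebra" where
  "A_omega \<Theta> \<omega> = W \<Theta> {..<arity \<Theta> \<omega>}"

definition op_word :: "'f var_data \<Rightarrow> 'f \<Rightarrow> 'f trm set" where
  "op_word \<Theta> \<omega> =
     operation (A_omega \<Theta> \<omega>) \<omega> (map (gen \<Theta> {..<arity \<Theta> \<omega>}) [0..<arity \<Theta> \<omega>])"

definition verbal :: "'f var_data \<Rightarrow> ('f, 'a) algebra \<Rightarrow> nat \<Rightarrow> 'f trm set \<Rightarrow> 'a list \<Rightarrow> 'a" where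
  "verbal \<Theta> H k w hs =
     (THE \<gamma>. \<gamma> \<in> homs \<Theta> (W \<Theta> {..<k}) H \<and> (\<forall>i<k. \<gamma> (gen \<Theta> {..<k} i) = hs ! i)) w"

definition induced_algebra :: "'f var_data \<Rightarrow> ('f \<Rightarrow> 'f trm set) \<Rightarrow> ('f, 'a) algebra
    \<Rightarrow> ('f, 'a) algebra" where
  "induced_algebra \<Theta> w H =
     \<lparr>carrier = carrier H, operation = (\<lambda>\<omega>. verbal \<Theta> H (arity \<Theta> \<omega>) (w \<omega>))\<rparr>"

definition ker :: "('f, 'a) algebra \<Rightarrow> ('a \<Rightarrow> 'b) \<Rightarrow> ('a \<times> 'a) set" where
  "ker B \<mu> = {(a, b). a \<in> carrier B \<and> b \<in> carrier B \<and> \<mu> a = \<mu> b}"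

definition prime_hom :: "'f var_data \<Rightarrow> ('f, 'h) algebra \<Rightarrow> ('f, 'a) algebra \<Rightarrow> ('a \<times> 'a) set
    \<Rightarrow> ('a \<Rightarrow> 'h) set" where
  "prime_hom \<Theta> H B T = {\<mu> \<in> homs \<Theta> B H. T \<subseteq> ker B \<mu>}"

(* The intersection is taken inside B^2, so that the empty set of homomorphisms yields B^2. *)
definition prime_rel :: "('f, 'a) algebra \<Rightarrow> ('a \<Rightarrow> 'h) set \<Rightarrow> ('a \<times> 'a) set" where
  "prime_rel B R = (carrier B \<times> carrier B) \<inter> (\<Inter>\<mu>\<in>R. ker B \<mu>)"

definition Cl :: "'f var_data \<Rightarrow> ('f, 'h) algebra \<Rightarrow> ('f, 'a) algebra \<Rightarrow> ('a \<times> 'a) set set" where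
  "Cl \<Theta> H B = {T. T \<subseteq> carrier B \<times> carrier B \<and> T = prime_rel B (prime_hom \<Theta> H B T)}"

definition nat_epi :: "('f, 'a) algebra \<Rightarrow> ('a \<times> 'a) set \<Rightarrow> 'a \<Rightarrow> 'a set" where
  "nat_epi B T = (\<lambda>b\<in>carrier B. T `` {b})"

definition provides_automorphic_equivalence ::
  "'f var_data \<Rightarrow> 'f endofunctor \<Rightarrow> ('f, 'h1) algebra \<Rightarrow> ('f, 'h2) algebra \<Rightarrow> bool" where
  "provides_automorphic_equivalence \<Theta> \<Psi> H1 H2 \<longleftrightarrow>
     automorphism \<Theta> \<Psi> \<and> in_variety \<Theta> H1 \<and> in_variety \<Theta> H2 \<and>
     (\<exists>\<alpha>.
       (\<forall>B\<in>Ob \<Theta>. bij_betw (\<alpha> B) (Cl \<Theta> H1 B) (Cl \<Theta> H2 (obj_map \<Psi> B))) \<and>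
       (\<forall>B1\<in>Ob \<Theta>. \<forall>B2\<in>Ob \<Theta>. \<forall>\<mu>1\<in>homs \<Theta> B1 B2. \<forall>\<mu>2\<in>homs \<Theta> B1 B2. \<forall>T\<in>Cl \<Theta> H1 B2.
          compose (carrier B1) (nat_epi B2 T) \<mu>1 = compose (carrier B1) (nat_epi B2 T) \<mu>2 \<longleftrightarrow>
          compose (carrier (obj_map \<Psi> B1)) (nat_epi (obj_map \<Psi> B2) (\<alpha> B2 T)) (arr_map \<Psi> B1 B2 \<mu>1) =
          compose (carrier (obj_map \<Psi> B1)) (nat_epi (obj_map \<Psi> B2) (\<alpha> B2 T)) (arr_map \<Psi> B1 B2 \<mu>2)))"

end

theory Submission
  imports Defs
begin

text \<open>
  Let \<open>s B\<close> be the bijections that represent \<open>\<Phi>\<close>, so that \<open>\<Phi> \<alpha> = s B \<circ> \<alpha> \<circ> (s A)\<^sup>-\<^sup>1\<close>, and let \<open>H*\<close> be the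
  algebra induced on \<open>H\<close> by the words \<open>w \<omega>\<close>. Everything rests on reading \<open>s B\<close> as an isomorphism
  between \<open>B\<close> and \<open>B*\<close> (\<open>s_hom\<close>): a tuple \<open>b\<close> in \<open>B\<close> is the image of the generators under some
  \<open>\<alpha> : A_omega \<rightarrow> B\<close>; since the \<open>s\<close> fix generators, \<open>\<Phi> \<alpha>\<close> maps the generators to \<open>s B b\<close>, and evaluating
  \<open>\<Phi> \<alpha> \<circ> s = s B \<circ> \<alpha>\<close> at \<open>\<omega>(x)\<close> says that the operation \<open>w \<omega>\<close> applied to \<open>s B b\<close> is \<open>s B (\<omega> b)\<close>.

  Membership of \<open>H*\<close> in the variety (\<open>in_variety_star\<close>) follows. It holds for \<open>B*\<close>, which is isomorphic
  to \<open>B\<close>. For arbitrary \<open>H\<close>, the finitely many values in \<open>H\<close> that an identity speaks of come from the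
  generators of a free algebra \<open>B\<close> along a homomorphism \<open>B \<rightarrow> H\<close>, and homomorphisms \<open>B \<rightarrow> H\<close> are also
  homomorphisms \<open>B* \<rightarrow> H*\<close>, because verbal operations are natural.

  The key step is that \<open>\<mu> \<mapsto> \<mu> \<circ> s B\<close> maps \<open>Hom(B, H)\<close> onto \<open>Hom(B, H*)\<close> (\<open>homs_star\<close>). The kernel of
  \<open>\<mu> \<circ> s B\<close> is the preimage of the kernel of \<open>\<mu>\<close> under \<open>s B \<times> s B\<close>, hence taking this preimage carries the
  \<open>H\<close>-closed congruences bijectively to the \<open>H*\<close>-closed ones (\<open>bij_betw_pullback_Cl\<close>). This bijection is
  the required one: \<open>\<Phi>\<^sup>-\<^sup>1 \<mu> = (s B)\<^sup>-\<^sup>1 \<circ> \<mu> \<circ> s A\<close>, so the pair of values of \<open>\<Phi>\<^sup>-\<^sup>1 \<mu>1\<close> and \<open>\<Phi>\<^sup>-\<^sup>1 \<mu>2\<close> at \<open>a\<close> lies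
  in the preimage of \<open>T\<close> iff the pair of values of \<open>\<mu>1\<close> and \<open>\<mu>2\<close> at \<open>s A a\<close> lies in \<open>T\<close>, and \<open>s A a\<close>
  runs over all of \<open>A\<close>.
\<close>

section \<open>Terms, evaluation and homomorphisms\<close>

lemma subst_terms:
  assumes "t \<in> terms \<Theta> Y" and "\<And>x. x \<in> Y \<Longrightarrow> \<sigma> x \<in> terms \<Theta> X"
  shows "subst \<sigma> t \<in> terms \<Theta> X"
  using assms(1) by induction (auto intro!: terms.intros assms(2))

lemma eval_closed:
  assumes "t \<in> terms \<Theta> X" and "is_algebra \<Theta> H" and "\<And>x. x \<in> X \<Longrightarrow> h x \<in> carrier H"
  shows "eval H h t \<in> carrier H"
  using assms(1)
proof induction
  case (App f ts)
  have "set (map (eval H h) ts) \<subseteq> carrier H" using App by auto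
  then show ?case using App assms(2) unfolding is_algebra_def by simp
qed (simp add: assms(3))

lemma eval_subst: "eval H h (subst \<sigma> t) = eval H (\<lambda>x. eval H h (\<sigma> x)) t"
  by (induction t) (auto intro!: arg_cong[of _ _ "operation H _"])

lemma eval_agree:
  assumes "t \<in> terms \<Theta> X" and "\<And>x. x \<in> X \<Longrightarrow> h x = g x"
  shows "eval H h t = eval H g t"
  using assms(1) by induction (auto intro!: arg_cong[of _ _ "operation H _"] assms(2))

text \<open>A term uses finitely many variables. The bound is stated for all large \<open>m\<close> so that both sides of an
  identity can be placed over one and the same finite set of generators.\<close>

lemma terms_finite_vars:
  assumes "t \<in> terms \<Theta> UNIV"
  shows "\<exists>n. \<forall>m\<ge>n. t \<in> terms \<Theta> {..<m}"
  using assms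
proof induction
  case (Var x)
  then show ?case by (intro exI[of _ "Suc x"]) (auto intro: terms.Var)
next
  case (App f ts)
  then obtain n where n: "\<And>t m. t \<in> set ts \<Longrightarrow> m \<ge> n t \<Longrightarrow> t \<in> terms \<Theta> {..<m}"
    by metis
  show ?case
  proof (intro exI[of _ "\<Sum>t\<in>set ts. n t"] allI impI)
    fix m assume m: "(\<Sum>t\<in>set ts. n t) \<le> m"
    have "n t \<le> m" if "t \<in> set ts" for t
      using member_le_sum[of t "set ts" n] that m by simp
    then show "App f ts \<in> terms \<Theta> {..<m}"
      using App n by (intro terms.App) auto
  qed
qed

lemma homs_carrier: "\<alpha> \<in> homs \<Theta> A B \<Longrightarrow> a \<in> carrier A \<Longrightarrow> \<alpha> a \<in> carrier B"
  unfolding homs_def by auto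

lemma homs_operation:
  "\<lbrakk>\<alpha> \<in> homs \<Theta> A B; f \<in> symbols \<Theta>; length as = arity \<Theta> f; set as \<subseteq> carrier A\<rbrakk>
    \<Longrightarrow> \<alpha> (operation A f as) = operation B f (map \<alpha> as)"
  unfolding homs_def by auto

lemma homs_extensional: "\<alpha> \<in> homs \<Theta> A B \<Longrightarrow> \<alpha> \<in> extensional (carrier A)"
  unfolding homs_def by (auto simp: PiE_def)

lemma homsI:
  assumes "\<And>a. a \<in> carrier A \<Longrightarrow> \<alpha> a \<in> carrier B" and "\<alpha> \<in> extensional (carrier A)"
    and "\<And>f as. \<lbrakk>f \<in> symbols \<Theta>; length as = arity \<Theta> f; set as \<subseteq> carrier A\<rbrakk>
      \<Longrightarrow> \<alpha> (operation A f as) = operation B f (map \<alpha> as)"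
  shows "\<alpha> \<in> homs \<Theta> A B"
  using assms unfolding homs_def by (auto simp: PiE_def)

lemma operation_closed:
  "\<lbrakk>is_algebra \<Theta> H; f \<in> symbols \<Theta>; length as = arity \<Theta> f; set as \<subseteq> carrier H\<rbrakk>
    \<Longrightarrow> operation H f as \<in> carrier H"
  unfolding is_algebra_def by auto

lemma homs_compose:
  assumes "\<alpha> \<in> homs \<Theta> A B" and "\<beta> \<in> homs \<Theta> B C" and "is_algebra \<Theta> A"
  shows "compose (carrier A) \<beta> \<alpha> \<in> homs \<Theta> A C"
proof (rule homsI)
  fix f as assume f: "f \<in> symbols \<Theta>" "length as = arity \<Theta> f" "set as \<subseteq> carrier A"
  have "map (compose (carrier A) \<beta> \<alpha>) as = map \<beta> (map \<alpha> as)"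
    using f(3) by (simp add: compose_def subset_iff)
  moreover have "set (map \<alpha> as) \<subseteq> carrier B"
    using f(3) homs_carrier[OF assms(1)] by auto
  ultimately show "compose (carrier A) \<beta> \<alpha> (operation A f as)
      = operation C f (map (compose (carrier A) \<beta> \<alpha>) as)"
    using f(2) homs_operation[OF assms(2) f(1), of "map \<alpha> as"]
    by (simp del: map_map map_eq_conv add: compose_eq operation_closed[OF assms(3) f] homs_operation[OF assms(1) f])
qed (auto simp: compose_def intro!: homs_carrier[OF assms(1)] homs_carrier[OF assms(2)])

lemma homs_id:
  assumes "is_algebra \<Theta> A"
  shows "(\<lambda>x\<in>carrier A. x) \<in> homs \<Theta> A A"
proof (rule homsI)
  fix f as assume f: "f \<in> symbols \<Theta>" "length as = arity \<Theta> f" "set as \<subseteq> carrier A"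
  have "map (\<lambda>x\<in>carrier A. x) as = as" using f(3) by (auto intro!: map_idI)
  then show "(\<lambda>x\<in>carrier A. x) (operation A f as) = operation A f (map (\<lambda>x\<in>carrier A. x) as)"
    using operation_closed[OF assms f] by simp
qed auto

lemma homs_eval:
  assumes "t \<in> terms \<Theta> X" and "\<alpha> \<in> homs \<Theta> A B" and "is_algebra \<Theta> A"
    and "\<And>x. x \<in> X \<Longrightarrow> h x \<in> carrier A"
  shows "\<alpha> (eval A h t) = eval B (\<lambda>x. \<alpha> (h x)) t"
  using assms(1)
proof induction
  case (App f ts)
  have "set (map (eval A h) ts) \<subseteq> carrier A"
    using App eval_closed[OF _ assms(3,4)] by auto
  then show ?case
    using App homs_operation[OF assms(2)] by (auto intro!: arg_cong[of _ _ "operation B _"])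
qed simp

lemma in_varietyD: "in_variety \<Theta> H \<Longrightarrow> is_algebra \<Theta> H"
  unfolding in_variety_def by simp

lemma in_varietyI:
  assumes "is_algebra \<Theta> H"
    and "\<And>u v h. \<lbrakk>(u, v) \<in> identities \<Theta>; \<And>x. h x \<in> carrier H\<rbrakk> \<Longrightarrow> eval H h u = eval H h v"
  shows "in_variety \<Theta> H"
  using assms unfolding in_variety_def by blast

lemma in_variety_identity:
  "\<lbrakk>in_variety \<Theta> H; (u, v) \<in> identities \<Theta>; \<And>x. h x \<in> carrier H\<rbrakk> \<Longrightarrow> eval H h u = eval H h v"
  unfolding in_variety_def by blast

lemma identities_terms:
  "\<lbrakk>variety \<Theta>; (u, v) \<in> identities \<Theta>\<rbrakk> \<Longrightarrow> u \<in> terms \<Theta> UNIV \<and> v \<in> terms \<Theta> UNIV"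
  unfolding variety_def by auto

text \<open>Argument tuples and valuations in \<open>B\<close> lift along \<open>\<phi>\<close>: the first gives that the carrier of \<open>B\<close> is
  closed under the operations, the second that the identities hold.\<close>

lemma in_variety_homomorphic_image:
  assumes var: "variety \<Theta>" and A: "in_variety \<Theta> A" and \<phi>: "\<phi> \<in> homs \<Theta> A B"
    and onto: "\<phi> ` carrier A = carrier B"
  shows "in_variety \<Theta> B"
proof (rule in_varietyI)
  define r where "r b = inv_into (carrier A) \<phi> b" for b
  have r: "r b \<in> carrier A" "\<phi> (r b) = b" if "b \<in> carrier B" for b
    using that onto unfolding r_def by (auto intro: inv_into_into f_inv_into_f)
  show "is_algebra \<Theta> B"
    unfolding is_algebra_def
  proof (intro ballI allI impI, elim conjE)
    fix f as assume f: "f \<in> symbols \<Theta>" "length as = arity \<Theta> f" "set as \<subseteq> carrier B"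
    have *: "set (map r as) \<subseteq> carrier A" "length (map r as) = arity \<Theta> f"
      using f r by auto
    have "map \<phi> (map r as) = as" using f(3) r(2) by (auto simp: intro!: map_idI)
    then show "operation B f as \<in> carrier B"
      using homs_operation[OF \<phi> f(1) *(2,1)] operation_closed[OF in_varietyD[OF A] f(1) *(2,1)]
        homs_carrier[OF \<phi>] by metis
  qed
  fix u v and h :: "nat \<Rightarrow> 'c"
  assume uv: "(u, v) \<in> identities \<Theta>" and h: "\<And>x. h x \<in> carrier B"
  have *: "eval B h t = \<phi> (eval A (\<lambda>x. r (h x)) t)" if "t \<in> terms \<Theta> UNIV" for t
    using homs_eval[OF that \<phi> in_varietyD[OF A], of "\<lambda>x. r (h x)"] r h by simp
  show "eval B h u = eval B h v"
    using in_variety_identity[OF A uv, of "\<lambda>x. r (h x)"] * identities_terms[OF var uv] r h by simp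
qed

section \<open>The free algebras\<close>

lemma free_cong_terms:
  assumes "variety \<Theta>" and "(s, t) \<in> free_cong \<Theta> X"
  shows "s \<in> terms \<Theta> X \<and> t \<in> terms \<Theta> X"
  using assms(2)
proof induction
  case (inst u v \<sigma>)
  then show ?case using identities_terms[OF assms(1)] subst_terms by blast
next
  case (cong f ss ts)
  then show ?case by (auto intro!: terms.App simp: in_set_conv_nth)
qed auto

lemma equiv_free_cong:
  assumes "variety \<Theta>"
  shows "equiv (terms \<Theta> X) (free_cong \<Theta> X)"
proof (rule equivI)
  show "free_cong \<Theta> X \<subseteq> terms \<Theta> X \<times> terms \<Theta> X"
    using free_cong_terms[OF assms] by auto
  show "refl_on (terms \<Theta> X) (free_cong \<Theta> X)"
    using free_cong_terms[OF assms] by (auto simp: refl_on_def intro: free_cong.refl)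
  show "sym (free_cong \<Theta> X)" by (auto simp: sym_def intro: free_cong.sym)
  show "trans (free_cong \<Theta> X)" by (auto simp: trans_def intro: free_cong.trans)
qed

definition cls :: "'f var_data \<Rightarrow> nat set \<Rightarrow> 'f trm \<Rightarrow> 'f trm set" where
  "cls \<Theta> X t = free_cong \<Theta> X `` {t}"

lemma gen_eq_cls: "gen \<Theta> X x = cls \<Theta> X (Var x)"
  unfolding gen_def cls_def ..

lemma carrier_W: "carrier (W \<Theta> X) = cls \<Theta> X ` terms \<Theta> X"
  unfolding W_def cls_def quotient_def by auto

lemma cls_eq_iff:
  assumes "variety \<Theta>" and "s \<in> terms \<Theta> X" and "t \<in> terms \<Theta> X"
  shows "cls \<Theta> X s = cls \<Theta> X t \<longleftrightarrow> (s, t) \<in> free_cong \<Theta> X"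
  unfolding cls_def using eq_equiv_class_iff[OF equiv_free_cong] assms by blast

text \<open>The operations of \<open>W \<Theta> X\<close> are defined through all representatives at once; the congruence rule makes
  any one choice of representatives sufficient.\<close>

lemma operation_W:
  assumes var: "variety \<Theta>" and f: "f \<in> symbols \<Theta>" "length ts = arity \<Theta> f"
    and ts: "set ts \<subseteq> terms \<Theta> X"
  shows "operation (W \<Theta> X) f (map (cls \<Theta> X) ts) = cls \<Theta> X (App f ts)"
proof -
  have "(App f us, t) \<in> free_cong \<Theta> X \<longleftrightarrow> (App f ts, t) \<in> free_cong \<Theta> X"
    if us: "list_all2 (\<in>) us (map (cls \<Theta> X) ts)" for us t
  proof -
    have "(App f ts, App f us) \<in> free_cong \<Theta> X"
    proof (rule free_cong.cong[OF f])
      show "length us = arity \<Theta> f" using us f(2) by (auto dest: list_all2_lengthD)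
      show "\<forall>i<arity \<Theta> f. (ts ! i, us ! i) \<in> free_cong \<Theta> X"
        using us f(2) by (auto simp: list_all2_conv_all_nth cls_def)
    qed
    then show ?thesis by (metis free_cong.sym free_cong.trans)
  qed
  moreover have "list_all2 (\<in>) ts (map (cls \<Theta> X) ts)"
    using ts by (auto simp: list_all2_conv_all_nth cls_def intro!: free_cong.refl)
  ultimately show ?thesis
    unfolding W_def cls_def by auto
qed

lemma list_of_classes:
  assumes "set as \<subseteq> carrier (W \<Theta> X)"
  obtains ts where "as = map (cls \<Theta> X) ts" and "set ts \<subseteq> terms \<Theta> X"
proof -
  have "as \<in> map (cls \<Theta> X) ` lists (terms \<Theta> X)"
    using assms unfolding carrier_W lists_image[symmetric] by auto
  then show ?thesis using that by auto
qed

lemma is_algebra_W: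
  assumes "variety \<Theta>"
  shows "is_algebra \<Theta> (W \<Theta> X)"
  unfolding is_algebra_def
proof (intro ballI allI impI, elim conjE)
  fix f as assume f: "f \<in> symbols \<Theta>" "length as = arity \<Theta> f" and "set as \<subseteq> carrier (W \<Theta> X)"
  then obtain ts where ts: "as = map (cls \<Theta> X) ts" "set ts \<subseteq> terms \<Theta> X"
    by (blast elim: list_of_classes)
  then show "operation (W \<Theta> X) f as \<in> carrier (W \<Theta> X)"
    using operation_W[OF assms f(1), of ts X] f unfolding carrier_W by (auto intro!: terms.App)
qed

lemma eval_W:
  assumes var: "variety \<Theta>" and "t \<in> terms \<Theta> Y" and \<sigma>: "\<And>x. x \<in> Y \<Longrightarrow> \<sigma> x \<in> terms \<Theta> X"
  shows "eval (W \<Theta> X) (\<lambda>x. cls \<Theta> X (\<sigma> x)) t = cls \<Theta> X (subst \<sigma> t)"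
  using assms(2)
proof induction
  case (App f ts)
  have "set (map (subst \<sigma>) ts) \<subseteq> terms \<Theta> X"
    using App subst_terms[OF _ \<sigma>] by auto
  moreover have "map (eval (W \<Theta> X) (\<lambda>x. cls \<Theta> X (\<sigma> x))) ts = map (cls \<Theta> X) (map (subst \<sigma>) ts)"
    using App by auto
  ultimately show ?case
    using operation_W[OF var App(1), of "map (subst \<sigma>) ts" X] App(2)
    by (simp del: map_map map_eq_conv)
qed simp

text \<open>A valuation in \<open>W \<Theta> X\<close> lifts to a substitution by terms, and the substitution instances of the
  identities are among the pairs that generate \<open>free_cong\<close>.\<close>

lemma in_variety_W:
  assumes var: "variety \<Theta>"
  shows "in_variety \<Theta> (W \<Theta> X)"
proof (rule in_varietyI[OF is_algebra_W[OF var]])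
  fix u v and h :: "nat \<Rightarrow> 'a trm set"
  assume uv: "(u, v) \<in> identities \<Theta>" and "\<And>x. h x \<in> carrier (W \<Theta> X)"
  then have "\<forall>x. \<exists>t\<in>terms \<Theta> X. h x = cls \<Theta> X t" unfolding carrier_W by auto
  then obtain \<sigma> where \<sigma>: "\<And>x. \<sigma> x \<in> terms \<Theta> X" "\<And>x. h x = cls \<Theta> X (\<sigma> x)" by metis
  have h: "h = (\<lambda>x. cls \<Theta> X (\<sigma> x))" using \<sigma>(2) by auto
  have uv': "(subst \<sigma> u, subst \<sigma> v) \<in> free_cong \<Theta> X"
    by (intro free_cong.inst[OF uv] allI \<sigma>(1))
  have "cls \<Theta> X (subst \<sigma> u) = cls \<Theta> X (subst \<sigma> v)"
    using cls_eq_iff[OF var, of "subst \<sigma> u" X "subst \<sigma> v"] free_cong_terms[OF var uv'] uv' by simp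
  moreover have "eval (W \<Theta> X) h t = cls \<Theta> X (subst \<sigma> t)" if "t \<in> terms \<Theta> UNIV" for t
    unfolding h by (rule eval_W[OF var that \<sigma>(1)])
  ultimately show "eval (W \<Theta> X) h u = eval (W \<Theta> X) h v"
    using identities_terms[OF var uv] by simp
qed

lemma gen_carrier: "x \<in> X \<Longrightarrow> gen \<Theta> X x \<in> carrier (W \<Theta> X)"
  unfolding gen_eq_cls carrier_W by (auto intro: terms.Var)

lemma subst_Var: "subst Var t = t"
  by (induction t) (simp_all add: map_idI)

lemma W_generated:
  assumes "variety \<Theta>" and "a \<in> carrier (W \<Theta> X)"
  obtains t where "t \<in> terms \<Theta> X" and "a = eval (W \<Theta> X) (gen \<Theta> X) t"
proof -
  obtain t where t: "t \<in> terms \<Theta> X" "a = cls \<Theta> X t" using assms(2) unfolding carrier_W by auto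
  moreover have "eval (W \<Theta> X) (gen \<Theta> X) t = cls \<Theta> X t"
    using eval_W[OF assms(1) t(1), of Var X] by (simp add: subst_Var gen_eq_cls[abs_def] terms.Var)
  ultimately show ?thesis using that by simp
qed

lemma homs_W_eqI:
  assumes var: "variety \<Theta>" and "\<alpha> \<in> homs \<Theta> (W \<Theta> X) H" and "\<beta> \<in> homs \<Theta> (W \<Theta> X) H"
    and gens: "\<And>x. x \<in> X \<Longrightarrow> \<alpha> (gen \<Theta> X x) = \<beta> (gen \<Theta> X x)"
  shows "\<alpha> = \<beta>"
proof (rule extensionalityI[OF homs_extensional[OF assms(2)] homs_extensional[OF assms(3)]])
  fix a assume "a \<in> carrier (W \<Theta> X)"
  then obtain t where t: "t \<in> terms \<Theta> X" "a = eval (W \<Theta> X) (gen \<Theta> X) t"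
    using W_generated[OF var] by blast
  have "\<alpha> a = eval H (\<lambda>x. \<alpha> (gen \<Theta> X x)) t" and "\<beta> a = eval H (\<lambda>x. \<beta> (gen \<Theta> X x)) t"
    unfolding t(2) by (intro homs_eval[OF t(1) _ is_algebra_W[OF var] gen_carrier] assms; assumption)+
  then show "\<alpha> a = \<beta> a"
    using eval_agree[OF t(1) gens] by simp
qed

text \<open>Soundness of equational reasoning: what makes evaluation well defined on the classes of \<open>W \<Theta> X\<close>.\<close>

lemma eval_free_cong:
  assumes H: "in_variety \<Theta> H" and "(s, t) \<in> free_cong \<Theta> X" and h: "\<And>x. x \<in> X \<Longrightarrow> h x \<in> carrier H"
  shows "eval H h s = eval H h t"
  using assms(2)
proof induction
  case (inst u v \<sigma>)
  have "eval H h (\<sigma> x) \<in> carrier H" for x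
    using eval_closed[OF inst(2)[rule_format] in_varietyD[OF H] h] .
  then show ?case
    unfolding eval_subst by (rule in_variety_identity[OF H inst(1)])
next
  case (cong f ss ts)
  then have "map (eval H h) ss = map (eval H h) ts" by (intro nth_equalityI) simp_all
  then show ?case by (simp only: eval.simps)
qed simp_all

text \<open>The universal property of the free algebra; uniqueness is \<open>homs_W_eqI\<close>. As \<open>h\<close> is constrained on \<open>X\<close>
  only, the empty algebra is covered: then \<open>X\<close> is empty too.\<close>

lemma W_free:
  assumes var: "variety \<Theta>" and H: "in_variety \<Theta> H" and h: "\<And>x. x \<in> X \<Longrightarrow> h x \<in> carrier H"
  obtains \<gamma> where "\<gamma> \<in> homs \<Theta> (W \<Theta> X) H" and "\<And>x. x \<in> X \<Longrightarrow> \<gamma> (gen \<Theta> X x) = h x"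
proof -
  define \<gamma> where "\<gamma> = (\<lambda>a\<in>carrier (W \<Theta> X). eval H h (SOME t. t \<in> a))"
  have \<gamma>: "\<gamma> (cls \<Theta> X t) = eval H h t" if t: "t \<in> terms \<Theta> X" for t
  proof -
    have "(SOME s. s \<in> cls \<Theta> X t) \<in> cls \<Theta> X t"
      using t by (intro someI_ex[of "\<lambda>s. s \<in> cls \<Theta> X t"]) (auto simp: cls_def intro: free_cong.refl)
    then have "eval H h t = eval H h (SOME s. s \<in> cls \<Theta> X t)"
      by (intro eval_free_cong[OF H _ h]) (auto simp: cls_def)
    then show ?thesis using t unfolding \<gamma>_def by (simp add: carrier_W)
  qed
  have "\<gamma> \<in> homs \<Theta> (W \<Theta> X) H"
  proof (rule homsI)
    fix f as assume f: "f \<in> symbols \<Theta>" "length as = arity \<Theta> f" and "set as \<subseteq> carrier (W \<Theta> X)"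
    then obtain ts where ts: "as = map (cls \<Theta> X) ts" "set ts \<subseteq> terms \<Theta> X"
      by (blast elim: list_of_classes)
    then have "App f ts \<in> terms \<Theta> X" using f by (auto intro: terms.App)
    moreover have "map \<gamma> as = map (eval H h) ts" using ts \<gamma> by auto
    ultimately show "\<gamma> (operation (W \<Theta> X) f as) = operation H f (map \<gamma> as)"
      using ts f \<gamma> operation_W[OF var f(1), of ts X] by (simp del: map_map map_eq_conv)
  next
    fix a assume "a \<in> carrier (W \<Theta> X)"
    then show "\<gamma> a \<in> carrier H"
      unfolding carrier_W using \<gamma> eval_closed[OF _ in_varietyD[OF H] h] by auto
  qed (simp add: \<gamma>_def)
  moreover have "\<gamma> (gen \<Theta> X x) = h x" if "x \<in> X" for x
    using \<gamma>[of "Var x"] that by (simp add: gen_eq_cls terms.Var)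
  ultimately show ?thesis using that by blast
qed

section \<open>Verbal operations\<close>

lemma verbal_eq:
  assumes "variety \<Theta>" and "\<gamma> \<in> homs \<Theta> (W \<Theta> {..<k}) H" and "\<And>i. i < k \<Longrightarrow> \<gamma> (gen \<Theta> {..<k} i) = hs ! i"
  shows "verbal \<Theta> H k w hs = \<gamma> w"
proof -
  have "(THE \<gamma>. \<gamma> \<in> homs \<Theta> (W \<Theta> {..<k}) H \<and> (\<forall>i<k. \<gamma> (gen \<Theta> {..<k} i) = hs ! i)) = \<gamma>"
  proof (rule the_equality)
    fix \<delta> assume "\<delta> \<in> homs \<Theta> (W \<Theta> {..<k}) H \<and> (\<forall>i<k. \<delta> (gen \<Theta> {..<k} i) = hs ! i)"
    then show "\<delta> = \<gamma>" using assms by (intro homs_W_eqI[OF assms(1)]) auto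
  qed (use assms in auto)
  then show ?thesis unfolding verbal_def by simp
qed

lemma list_hom:
  assumes "variety \<Theta>" and "in_variety \<Theta> H" and "length hs = k" and "set hs \<subseteq> carrier H"
  obtains \<gamma> where "\<gamma> \<in> homs \<Theta> (W \<Theta> {..<k}) H" and "\<And>i. i < k \<Longrightarrow> \<gamma> (gen \<Theta> {..<k} i) = hs ! i"
proof -
  have "hs ! i \<in> carrier H" if "i \<in> {..<k}" for i using assms(3,4) that by auto
  then show ?thesis using W_free[OF assms(1,2), of "{..<k}" "\<lambda>i. hs ! i"] that by auto
qed

text \<open>Verbal operations are natural in the algebra: the homomorphism from \<open>W\<close> that evaluates words at
  \<open>map \<mu> bs\<close> is the one that evaluates at \<open>bs\<close> followed by \<open>\<mu>\<close>.\<close>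

lemma homs_verbal:
  assumes var: "variety \<Theta>" and B: "in_variety \<Theta> B" and \<mu>: "\<mu> \<in> homs \<Theta> B H"
    and w: "w \<in> carrier (W \<Theta> {..<k})" and bs: "length bs = k" "set bs \<subseteq> carrier B"
  shows "\<mu> (verbal \<Theta> B k w bs) = verbal \<Theta> H k w (map \<mu> bs)"
proof -
  obtain \<gamma> where \<gamma>: "\<gamma> \<in> homs \<Theta> (W \<Theta> {..<k}) B" "\<And>i. i < k \<Longrightarrow> \<gamma> (gen \<Theta> {..<k} i) = bs ! i"
    using list_hom[OF var B bs] by blast
  have "verbal \<Theta> H k w (map \<mu> bs) = compose (carrier (W \<Theta> {..<k})) \<mu> \<gamma> w"
  proof (rule verbal_eq[OF var homs_compose[OF \<gamma>(1) \<mu> is_algebra_W[OF var]]])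
    fix i assume "i < k"
    then show "compose (carrier (W \<Theta> {..<k})) \<mu> \<gamma> (gen \<Theta> {..<k} i) = map \<mu> bs ! i"
      using \<gamma>(2) bs(1) gen_carrier[of i "{..<k}" \<Theta>] by (simp add: compose_def)
  qed
  then show ?thesis using verbal_eq[OF var \<gamma>] w by (simp add: compose_def)
qed

lemma verbal_closed:
  assumes "variety \<Theta>" and "in_variety \<Theta> H" and "w \<in> carrier (W \<Theta> {..<k})"
    and "length hs = k" and "set hs \<subseteq> carrier H"
  shows "verbal \<Theta> H k w hs \<in> carrier H"
proof -
  obtain \<gamma> where \<gamma>: "\<gamma> \<in> homs \<Theta> (W \<Theta> {..<k}) H" "\<And>i. i < k \<Longrightarrow> \<gamma> (gen \<Theta> {..<k} i) = hs ! i"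
    using list_hom[OF assms(1,2,4,5)] by blast
  show ?thesis
    using verbal_eq[OF assms(1) \<gamma>] homs_carrier[OF \<gamma>(1) assms(3)] by simp
qed

lemma carrier_induced [simp]: "carrier (induced_algebra \<Theta> w H) = carrier H"
  unfolding induced_algebra_def by simp

lemma operation_induced [simp]:
  "operation (induced_algebra \<Theta> w H) \<omega> = verbal \<Theta> H (arity \<Theta> \<omega>) (w \<omega>)"
  unfolding induced_algebra_def by simp

lemma is_algebra_induced:
  assumes "variety \<Theta>" and "in_variety \<Theta> H"
    and "\<And>\<omega>. \<omega> \<in> symbols \<Theta> \<Longrightarrow> w \<omega> \<in> carrier (A_omega \<Theta> \<omega>)"
  shows "is_algebra \<Theta> (induced_algebra \<Theta> w H)"
  unfolding is_algebra_def
  using verbal_closed[OF assms(1,2) assms(3)[unfolded A_omega_def]] by simp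

lemma homs_induced:
  assumes "variety \<Theta>" and "in_variety \<Theta> B" and "\<mu> \<in> homs \<Theta> B H"
    and "\<And>\<omega>. \<omega> \<in> symbols \<Theta> \<Longrightarrow> w \<omega> \<in> carrier (A_omega \<Theta> \<omega>)"
  shows "\<mu> \<in> homs \<Theta> (induced_algebra \<Theta> w B) (induced_algebra \<Theta> w H)"
proof (rule homsI)
  fix f as
  assume f: "f \<in> symbols \<Theta>" and as: "length as = arity \<Theta> f" "set as \<subseteq> carrier (induced_algebra \<Theta> w B)"
  have "w f \<in> carrier (W \<Theta> {..<arity \<Theta> f})" using assms(4)[OF f] unfolding A_omega_def .
  from homs_verbal[OF assms(1-3) this as(1)] as(2)
  show "\<mu> (operation (induced_algebra \<Theta> w B) f as) = operation (induced_algebra \<Theta> w H) f (map \<mu> as)"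
    by simp
next
  show "\<mu> a \<in> carrier (induced_algebra \<Theta> w H)" if "a \<in> carrier (induced_algebra \<Theta> w B)" for a
    using homs_carrier[OF assms(3)] that by simp
  show "\<mu> \<in> extensional (carrier (induced_algebra \<Theta> w B))"
    using homs_extensional[OF assms(3)] by simp
qed

section \<open>The inverse of an automorphism\<close>

lemma Ob_in_variety: "variety \<Theta> \<Longrightarrow> B \<in> Ob \<Theta> \<Longrightarrow> in_variety \<Theta> B"
  unfolding Ob_def by (auto intro: in_variety_W)

lemma automorphism_inv_functor:
  assumes var: "variety \<Theta>" and \<Phi>: "automorphism \<Theta> \<Phi>"
  shows "automorphism \<Theta> (inv_functor \<Theta> \<Phi>)"
proof -
  define G where "G = inv_into (Ob \<Theta>) (obj_map \<Phi>)"
  define F where "F A B = arr_map \<Phi> (G A) (G B)" for A B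
  define K where "K A B = inv_into (homs \<Theta> (G A) (G B)) (F A B)" for A B
  note \<Phi>' = \<Phi>[unfolded automorphism_def]
  note ob = \<Phi>'[THEN conjunct1]
    and ar = \<Phi>'[THEN conjunct2, THEN conjunct1, rule_format]
    and idn = \<Phi>'[THEN conjunct2, THEN conjunct2, THEN conjunct1, rule_format]
    and comp = \<Phi>'[THEN conjunct2, THEN conjunct2, THEN conjunct2, rule_format]
  have Gb: "bij_betw G (Ob \<Theta>) (Ob \<Theta>)" unfolding G_def by (rule bij_betw_inv_into[OF ob])
  have G: "G A \<in> Ob \<Theta>" "obj_map \<Phi> (G A) = A" if "A \<in> Ob \<Theta>" for A
    using bij_betwE[OF Gb] bij_betw_inv_into_right[OF ob that] that unfolding G_def by blast+
  have Fb: "bij_betw (F A B) (homs \<Theta> (G A) (G B)) (homs \<Theta> A B)" if "A \<in> Ob \<Theta>" "B \<in> Ob \<Theta>" for A B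
    using ar[OF G(1)[OF that(1)] G(1)[OF that(2)]] G(2) that unfolding F_def by simp
  have Kb: "bij_betw (K A B) (homs \<Theta> A B) (homs \<Theta> (G A) (G B))" if "A \<in> Ob \<Theta>" "B \<in> Ob \<Theta>" for A B
    unfolding K_def by (rule bij_betw_inv_into[OF Fb[OF that]])
  have K: "K A B \<mu> \<in> homs \<Theta> (G A) (G B)" "F A B (K A B \<mu>) = \<mu>"
    if "A \<in> Ob \<Theta>" "B \<in> Ob \<Theta>" "\<mu> \<in> homs \<Theta> A B" for A B \<mu>
    using bij_betwE[OF Kb[OF that(1,2)]] bij_betw_inv_into_right[OF Fb[OF that(1,2)] that(3)] that(3)
    unfolding K_def by blast+
  have KI: "K A B \<mu> = \<nu>" if "A \<in> Ob \<Theta>" "B \<in> Ob \<Theta>" "\<nu> \<in> homs \<Theta> (G A) (G B)" "F A B \<nu> = \<mu>" for A B \<mu> \<nu>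
    using bij_betw_inv_into_left[OF Fb[OF that(1,2)] that(3)] that(4) unfolding K_def by simp
  have alg: "is_algebra \<Theta> A" if "A \<in> Ob \<Theta>" for A
    using in_varietyD[OF Ob_in_variety[OF var that]] .
  have 1: "obj_map (inv_functor \<Theta> \<Phi>) = G" "arr_map (inv_functor \<Theta> \<Phi>) = K"
    unfolding inv_functor_def G_def K_def F_def by (simp_all add: Let_def fun_eq_iff)
  show ?thesis
    unfolding automorphism_def 1
  proof (intro conjI ballI Gb Kb)
    fix A assume A: "A \<in> Ob \<Theta>"
    show "K A A (\<lambda>x\<in>carrier A. x) = (\<lambda>x\<in>carrier (G A). x)"
      using idn[OF G(1)[OF A]] G(2)[OF A] by (intro KI A homs_id alg G) (simp add: F_def)
  next
    fix A B C \<alpha> \<beta>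
    assume *: "A \<in> Ob \<Theta>" "B \<in> Ob \<Theta>" "C \<in> Ob \<Theta>" "\<alpha> \<in> homs \<Theta> A B" "\<beta> \<in> homs \<Theta> B C"
    note a = K[OF *(1,2,4)] and b = K[OF *(2,3,5)]
    show "K A C (compose (carrier A) \<beta> \<alpha>) = compose (carrier (G A)) (K B C \<beta>) (K A B \<alpha>)"
    proof (rule KI[OF *(1,3) homs_compose[OF a(1) b(1) alg[OF G(1)[OF *(1)]]]])
      show "F A C (compose (carrier (G A)) (K B C \<beta>) (K A B \<alpha>)) = compose (carrier A) \<beta> \<alpha>"
        using comp[OF G(1)[OF *(1)] G(1)[OF *(2)] G(1)[OF *(3)] a(1) b(1)] a(2) b(2) G(2)[OF *(1)]
        by (simp add: F_def)
    qed
  qed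
qed

section \<open>Closed congruences\<close>

lemma Cl_equiv:
  assumes "T \<in> Cl \<Theta> H B"
  shows "equiv (carrier B) T"
proof -
  have "T = prime_rel B (prime_hom \<Theta> H B T)" using assms unfolding Cl_def by blast
  moreover have "equiv (carrier B) (prime_rel B R)" for R :: "('a \<Rightarrow> 'c) set"
    by (rule equivI) (auto simp: prime_rel_def ker_def refl_on_def sym_def trans_def)
  ultimately show ?thesis by metis
qed

lemma nat_epi_compose_eq_iff:
  assumes T: "equiv (carrier B) T" and \<mu>: "\<mu> \<in> homs \<Theta> A B" and \<nu>: "\<nu> \<in> homs \<Theta> A B"
  shows "compose (carrier A) (nat_epi B T) \<mu> = compose (carrier A) (nat_epi B T) \<nu> \<longleftrightarrow>
    (\<forall>a\<in>carrier A. (\<mu> a, \<nu> a) \<in> T)"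
proof -
  have "compose (carrier A) (nat_epi B T) \<mu> = compose (carrier A) (nat_epi B T) \<nu> \<longleftrightarrow>
    (\<forall>a\<in>carrier A. compose (carrier A) (nat_epi B T) \<mu> a = compose (carrier A) (nat_epi B T) \<nu> a)"
    by (metis compose_extensional extensionalityI)
  also have "\<dots> \<longleftrightarrow> (\<forall>a\<in>carrier A. T `` {\<mu> a} = T `` {\<nu> a})"
    using homs_carrier[OF \<mu>] homs_carrier[OF \<nu>] by (simp add: compose_eq nat_epi_def)
  also have "\<dots> \<longleftrightarrow> (\<forall>a\<in>carrier A. (\<mu> a, \<nu> a) \<in> T)"
    using eq_equiv_class_iff[OF T] homs_carrier[OF \<mu>] homs_carrier[OF \<nu>] by simp
  finally show ?thesis .
qed

definition pullback :: "('f, 'a) algebra \<Rightarrow> ('a \<Rightarrow> 'a) \<Rightarrow> ('a \<times> 'a) set \<Rightarrow> ('a \<times> 'a) set" where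
  "pullback B \<sigma> T = {(a, b). a \<in> carrier B \<and> b \<in> carrier B \<and> (\<sigma> a, \<sigma> b) \<in> T}"

text \<open>Pulling back along a bijection \<open>\<sigma>\<close> is an order isomorphism of the relations on \<open>B\<close>. If composition
  with \<open>\<sigma>\<close> turns the homomorphisms into \<open>H\<close> into those into \<open>K\<close>, it turns kernels into pulled-back kernels,
  so it commutes with both halves of the Galois connection that defines closedness.\<close>

lemma bij_betw_pullback_Cl:
  fixes H :: "('f, 'h) algebra" and K :: "('f, 'h) algebra" and B :: "('f, 'a) algebra"
  assumes \<sigma>: "bij_betw \<sigma> (carrier B) (carrier B)"
    and homs: "homs \<Theta> B K = (\<lambda>\<mu>. compose (carrier B) \<mu> \<sigma>) ` homs \<Theta> B H"
  shows "bij_betw (pullback B \<sigma>) (Cl \<Theta> H B) (Cl \<Theta> K B)"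
proof -
  let ?P = "Pow (carrier B \<times> carrier B)"
  have mem: "\<sigma> a \<in> carrier B" if "a \<in> carrier B" for a using bij_betwE[OF \<sigma>] that by blast
  have ker: "ker B (compose (carrier B) \<mu> \<sigma>) = pullback B \<sigma> (ker B \<mu>)" for \<mu> :: "'a \<Rightarrow> 'h"
    unfolding ker_def pullback_def by (intro Collect_cong) (auto simp: compose_eq mem)
  have sur: "\<exists>a'\<in>carrier B. a = \<sigma> a'" if "a \<in> carrier B" for a
    using that \<sigma> unfolding bij_betw_def by auto
  \<comment> \<open>As \<open>\<sigma>\<close> is onto, every pair of \<open>T\<close> is visible in its pullback.\<close>
  have sub: "pullback B \<sigma> T \<subseteq> pullback B \<sigma> T' \<longleftrightarrow> T \<subseteq> T'" if T: "T \<in> ?P" for T T'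
  proof
    assume *: "pullback B \<sigma> T \<subseteq> pullback B \<sigma> T'"
    show "T \<subseteq> T'"
    proof (rule subrelI)
      fix a b assume ab: "(a, b) \<in> T"
      then obtain a' b' where "a' \<in> carrier B" "b' \<in> carrier B" "a = \<sigma> a'" "b = \<sigma> b'"
        using T sur[of a] sur[of b] by blast
      then show "(a, b) \<in> T'" using * ab unfolding pullback_def by auto
    qed
  qed (auto simp: pullback_def)
  have inj: "T = T'" if "T \<in> ?P" "T' \<in> ?P" "pullback B \<sigma> T = pullback B \<sigma> T'" for T T'
    using sub[OF that(1), of T'] sub[OF that(2), of T] that(3) by auto
  have surj: "\<exists>T\<in>?P. U = pullback B \<sigma> T" if U: "U \<in> ?P" for U
  proof
    define V where "V = map_prod \<sigma> \<sigma> ` U"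
    show "V \<in> ?P" using U mem unfolding V_def by fastforce
    have "(\<sigma> a, \<sigma> b) \<in> V \<longleftrightarrow> (a, b) \<in> U" if "a \<in> carrier B" "b \<in> carrier B" for a b
      using inj_on_image_mem_iff[OF map_prod_inj_on, OF bij_betw_imp_inj_on[OF \<sigma>]
          bij_betw_imp_inj_on[OF \<sigma>], of "(a, b)" U] U that unfolding V_def by simp
    then show "U = pullback B \<sigma> V"
      using U unfolding pullback_def by auto
  qed
  have rel: "prime_rel B ((\<lambda>\<mu>. compose (carrier B) \<mu> \<sigma>) ` R) = pullback B \<sigma> (prime_rel B R)"
    for R :: "('a \<Rightarrow> 'h) set"
    unfolding prime_rel_def using mem by (auto simp: ker pullback_def)
  have hom: "prime_hom \<Theta> K B (pullback B \<sigma> T) = (\<lambda>\<mu>. compose (carrier B) \<mu> \<sigma>) ` prime_hom \<Theta> H B T"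
    if "T \<in> ?P" for T
    unfolding prime_hom_def homs by (simp only: Compr_image_eq ker sub[OF that])
  have "pullback B \<sigma> T \<in> ?P" for T by (auto simp: pullback_def)
  moreover have "prime_rel B R \<in> ?P" for R :: "('a \<Rightarrow> 'h) set" by (auto simp: prime_rel_def)
  ultimately have closed: "pullback B \<sigma> T \<in> Cl \<Theta> K B \<longleftrightarrow> T \<in> Cl \<Theta> H B" if "T \<in> ?P" for T
    using that inj[OF that, of "prime_rel B (prime_hom \<Theta> H B T)"]
    unfolding Cl_def by (auto simp: hom rel)
  show ?thesis
  proof (rule bij_betw_imageI)
    show "inj_on (pullback B \<sigma>) (Cl \<Theta> H B)" using inj by (auto simp: inj_on_def Cl_def)
    have P: "Cl \<Theta> H B \<subseteq> ?P" "Cl \<Theta> K B \<subseteq> ?P" unfolding Cl_def by auto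
    show "pullback B \<sigma> ` Cl \<Theta> H B = Cl \<Theta> K B"
    proof (intro equalityI subsetI)
      fix U assume U: "U \<in> Cl \<Theta> K B"
      then obtain T where "T \<in> ?P" "U = pullback B \<sigma> T" using surj[of U] P(2) by blast
      with U show "U \<in> pullback B \<sigma> ` Cl \<Theta> H B" using closed[of T] by blast
    next
      fix U assume "U \<in> pullback B \<sigma> ` Cl \<Theta> H B"
      then show "U \<in> Cl \<Theta> K B" using closed P(1) by blast
    qed
  qed
qed

section \<open>Strongly stable automorphisms\<close>

locale stable_system =
  fixes \<Theta> :: "'f var_data"
    and \<Phi> :: "'f endofunctor"
    and s :: "('f, 'f trm set) algebra \<Rightarrow> 'f trm set \<Rightarrow> 'f trm set"
    and w :: "'f \<Rightarrow> 'f trm set"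
  assumes var: "variety \<Theta>"
    and stable: "strongly_stable \<Theta> \<Phi>"
    and A2: "A2 \<Theta> \<Phi> s" and A3: "A3 \<Theta> s"
    and w: "\<And>\<omega>. \<omega> \<in> symbols \<Theta> \<Longrightarrow> w \<omega> = s (A_omega \<Theta> \<omega>) (op_word \<Theta> \<omega>)"
begin

abbreviation star :: "('f, 'a) algebra \<Rightarrow> ('f, 'a) algebra" where
  "star H \<equiv> induced_algebra \<Theta> w H"

lemma automorphism: "automorphism \<Theta> \<Phi>" and obj_map: "A \<in> Ob \<Theta> \<Longrightarrow> obj_map \<Phi> A = A"
  using stable unfolding strongly_stable_def A1_def by auto

lemma bij_s: "B \<in> Ob \<Theta> \<Longrightarrow> bij_betw (s B) (carrier B) (carrier B)"
  using A2 unfolding A2_def by blast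

lemma s_closed: "B \<in> Ob \<Theta> \<Longrightarrow> b \<in> carrier B \<Longrightarrow> s B b \<in> carrier B"
  using bij_betwE[OF bij_s] by blast

lemma s_gen: "finite X \<Longrightarrow> x \<in> X \<Longrightarrow> s (W \<Theta> X) (gen \<Theta> X x) = gen \<Theta> X x"
  using A3 unfolding A3_def by blast

lemma bij_arr_map:
  "A \<in> Ob \<Theta> \<Longrightarrow> B \<in> Ob \<Theta> \<Longrightarrow> bij_betw (arr_map \<Phi> A B) (homs \<Theta> A B) (homs \<Theta> A B)"
  using automorphism obj_map unfolding automorphism_def by metis

lemma arr_map_s:
  assumes "A \<in> Ob \<Theta>" and "B \<in> Ob \<Theta>" and "\<alpha> \<in> homs \<Theta> A B" and "a \<in> carrier A"
  shows "arr_map \<Phi> A B \<alpha> (s A a) = s B (\<alpha> a)"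
proof -
  have "arr_map \<Phi> A B \<alpha> = (\<lambda>a\<in>carrier A. s B (\<alpha> (inv_into (carrier A) (s A) a)))"
    using A2 assms(1-3) unfolding A2_def by blast
  then show ?thesis
    using assms s_closed bij_betw_inv_into_left[OF bij_s[OF assms(1)]] by simp
qed

lemma W_Ob: "finite X \<Longrightarrow> W \<Theta> X \<in> Ob \<Theta>"
  unfolding Ob_def by auto

lemma gens_carrier: "set (map (gen \<Theta> {..<k}) [0..<k]) \<subseteq> carrier (W \<Theta> {..<k})"
  by (auto intro: gen_carrier)

lemma op_word_carrier:
  assumes "\<omega> \<in> symbols \<Theta>"
  shows "op_word \<Theta> \<omega> \<in> carrier (W \<Theta> {..<arity \<Theta> \<omega>})"
  unfolding op_word_def A_omega_def
  by (rule operation_closed[OF is_algebra_W[OF var] assms _ gens_carrier]) simp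

lemma w_carrier: "\<omega> \<in> symbols \<Theta> \<Longrightarrow> w \<omega> \<in> carrier (A_omega \<Theta> \<omega>)"
  unfolding w A_omega_def by (intro s_closed W_Ob op_word_carrier) auto

text \<open>The identity \<open>\<Phi> \<alpha> \<circ> s A_omega = s B \<circ> \<alpha>\<close>, evaluated at \<open>\<omega>(x)\<close> for the \<open>\<alpha>\<close> that maps the generators
  to the arguments. Since \<open>\<Phi> \<alpha>\<close> is itself a homomorphism, its value at \<open>w \<omega>\<close> is given by the verbal
  operation.\<close>

lemma s_hom:
  assumes B: "B \<in> Ob \<Theta>"
  shows "restrict (s B) (carrier B) \<in> homs \<Theta> B (star B)"
proof (rule homsI)
  fix \<omega> bs assume \<omega>: "\<omega> \<in> symbols \<Theta>" and bs: "length bs = arity \<Theta> \<omega>" "set bs \<subseteq> carrier B"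
  let ?k = "arity \<Theta> \<omega>"
  let ?A = "W \<Theta> {..<?k}"
  have A: "?A \<in> Ob \<Theta>" by (rule W_Ob) simp
  obtain \<alpha> where \<alpha>: "\<alpha> \<in> homs \<Theta> ?A B" "\<And>i. i < ?k \<Longrightarrow> \<alpha> (gen \<Theta> {..<?k} i) = bs ! i"
    using list_hom[OF var Ob_in_variety[OF var B] bs] by blast
  define \<beta> where "\<beta> = arr_map \<Phi> ?A B \<alpha>"
  have \<beta>: "\<beta> \<in> homs \<Theta> ?A B"
    using bij_betwE[OF bij_arr_map[OF A B]] \<alpha>(1) unfolding \<beta>_def by blast
  have "map \<alpha> (map (gen \<Theta> {..<?k}) [0..<?k]) = bs"
    using \<alpha>(2) bs(1) by (auto intro: nth_equalityI)
  then have "\<alpha> (op_word \<Theta> \<omega>) = operation B \<omega> bs"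
    unfolding op_word_def A_omega_def
    using homs_operation[OF \<alpha>(1) \<omega> _ gens_carrier] by simp
  then have "s B (operation B \<omega> bs) = \<beta> (w \<omega>)"
    using arr_map_s[OF A B \<alpha>(1) op_word_carrier[OF \<omega>]] w[OF \<omega>] unfolding \<beta>_def A_omega_def by simp
  moreover have "\<beta> (gen \<Theta> {..<?k} i) = map (s B) bs ! i" if "i < ?k" for i
    using arr_map_s[OF A B \<alpha>(1) gen_carrier, of i] s_gen[of "{..<?k}" i] \<alpha>(2) that bs(1)
    unfolding \<beta>_def by simp
  then have "verbal \<Theta> B ?k (w \<omega>) (map (s B) bs) = \<beta> (w \<omega>)"
    by (rule verbal_eq[OF var \<beta>])
  moreover have "map (restrict (s B) (carrier B)) bs = map (s B) bs" using bs(2) by auto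
  ultimately show "restrict (s B) (carrier B) (operation B \<omega> bs)
      = operation (star B) \<omega> (map (restrict (s B) (carrier B)) bs)"
    using operation_closed[OF in_varietyD[OF Ob_in_variety[OF var B]] \<omega> bs]
    by (simp del: map_eq_conv)
qed (use s_closed[OF B] in auto)

lemma in_variety_star_free:
  assumes B: "B \<in> Ob \<Theta>"
  shows "in_variety \<Theta> (star B)"
proof (rule in_variety_homomorphic_image[OF var Ob_in_variety[OF var B] s_hom[OF B]])
  show "restrict (s B) (carrier B) ` carrier B = carrier (star B)"
    using bij_s[OF B] unfolding bij_betw_def by auto
qed

text \<open>Both sides of an identity are evaluated in \<open>star B\<close> at the generators of a finitely generated free
  algebra \<open>B\<close>, where the identity holds, and carried to \<open>star H\<close> by the homomorphism \<open>\<gamma> : B \<rightarrow> H\<close> that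
  sends the generators to the given values.\<close>

lemma in_variety_star:
  fixes H :: "('f, 'h) algebra"
  assumes H: "in_variety \<Theta> H"
  shows "in_variety \<Theta> (star H)"
proof (rule in_varietyI[OF is_algebra_induced[OF var H w_carrier]])
  fix u v and h :: "nat \<Rightarrow> 'h"
  assume uv: "(u, v) \<in> identities \<Theta>" and h: "\<And>x. h x \<in> carrier (star H)"
  obtain n m where n: "\<And>k. k \<ge> n \<Longrightarrow> u \<in> terms \<Theta> {..<k}" and m: "\<And>k. k \<ge> m \<Longrightarrow> v \<in> terms \<Theta> {..<k}"
    using identities_terms[OF var uv] terms_finite_vars by metis
  \<comment> \<open>\<open>k\<close> must be positive: the variables from \<open>k\<close> on also need values in \<open>B\<close>, and get generator \<open>0\<close>.\<close>
  define k where "k = Suc (n + m)"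
  let ?B = "W \<Theta> {..<k}"
  have B: "?B \<in> Ob \<Theta>" by (rule W_Ob) simp
  obtain \<gamma> where \<gamma>: "\<gamma> \<in> homs \<Theta> ?B H" "\<And>x. x \<in> {..<k} \<Longrightarrow> \<gamma> (gen \<Theta> {..<k} x) = h x"
    using W_free[OF var H, of "{..<k}" h] h by auto
  note \<gamma>' = homs_induced[where w = w, OF var Ob_in_variety[OF var B] \<gamma>(1) w_carrier]
  define g where "g x = gen \<Theta> {..<k} (if x < k then x else 0)" for x
  have g: "g x \<in> carrier (star ?B)" for x
    unfolding g_def by (auto intro: gen_carrier simp: k_def)
  have eval_h: "eval (star H) h t = \<gamma> (eval (star ?B) g t)" if t: "t \<in> terms \<Theta> {..<k}" for t
  proof -
    have "\<gamma> (eval (star ?B) g t) = eval (star H) (\<lambda>x. \<gamma> (g x)) t"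
      by (rule homs_eval[OF t \<gamma>' in_varietyD[OF in_variety_star_free[OF B]] g])
    also have "\<dots> = eval (star H) h t"
      using \<gamma>(2) by (intro eval_agree[OF t]) (simp add: g_def)
    finally show ?thesis ..
  qed
  have "eval (star ?B) g u = eval (star ?B) g v"
    by (rule in_variety_identity[OF in_variety_star_free[OF B] uv g])
  then show "eval (star H) h u = eval (star H) h v"
    using eval_h n m by (simp add: k_def)
qed

text \<open>A homomorphism \<open>\<nu> : B \<rightarrow> star H\<close> is recovered from its values on the generators: extend these to
  \<open>\<mu> : B \<rightarrow> H\<close> by freeness. Then \<open>\<mu> \<circ> s B\<close> is again a homomorphism into \<open>star H\<close>, and it agrees with \<open>\<nu>\<close>
  on the generators because \<open>s B\<close> fixes them. In this way the original operations need not be expressed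
  through the induced ones.\<close>

lemma homs_star:
  assumes B: "B \<in> Ob \<Theta>" and H: "in_variety \<Theta> H"
  shows "homs \<Theta> B (star H) = (\<lambda>\<mu>. compose (carrier B) \<mu> (s B)) ` homs \<Theta> B H"
proof (intro equalityI subsetI)
  have twist: "compose (carrier B) \<mu> (s B) \<in> homs \<Theta> B (star H)" if \<mu>: "\<mu> \<in> homs \<Theta> B H" for \<mu>
  proof -
    note BV = Ob_in_variety[OF var B]
    have "compose (carrier B) \<mu> (restrict (s B) (carrier B)) \<in> homs \<Theta> B (star H)"
      by (rule homs_compose[OF s_hom[OF B] homs_induced[OF var BV \<mu> w_carrier] in_varietyD[OF BV]])
    moreover have "compose (carrier B) \<mu> (restrict (s B) (carrier B)) = compose (carrier B) \<mu> (s B)"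
      by (auto simp: compose_def)
    ultimately show ?thesis by simp
  qed
  then show "\<nu> \<in> homs \<Theta> B (star H)" if "\<nu> \<in> (\<lambda>\<mu>. compose (carrier B) \<mu> (s B)) ` homs \<Theta> B H" for \<nu>
    using that by auto
  fix \<nu> assume \<nu>: "\<nu> \<in> homs \<Theta> B (star H)"
  obtain X where X: "finite X" "B = W \<Theta> X" using B unfolding Ob_def by auto
  have "\<nu> (gen \<Theta> X x) \<in> carrier H" if "x \<in> X" for x
    using homs_carrier[OF \<nu>] gen_carrier[OF that] X(2) by auto
  then obtain \<mu> where \<mu>: "\<mu> \<in> homs \<Theta> B H" "\<And>x. x \<in> X \<Longrightarrow> \<mu> (gen \<Theta> X x) = \<nu> (gen \<Theta> X x)"
    using W_free[OF var H, of X "\<lambda>x. \<nu> (gen \<Theta> X x)"] unfolding X(2) by blast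
  have "\<nu> = compose (carrier B) \<mu> (s B)"
    using \<nu> twist[OF \<mu>(1)] unfolding X(2)
  proof (rule homs_W_eqI[OF var])
    fix x assume x: "x \<in> X"
    show "\<nu> (gen \<Theta> X x) = compose (carrier (W \<Theta> X)) \<mu> (s (W \<Theta> X)) (gen \<Theta> X x)"
      using \<mu>(2)[OF x] s_gen[OF X(1) x] gen_carrier[OF x, of \<Theta>] by (simp add: compose_eq)
  qed
  then show "\<nu> \<in> (\<lambda>\<mu>. compose (carrier B) \<mu> (s B)) ` homs \<Theta> B H" using \<mu>(1) by blast
qed

lemma obj_map_inv: "B \<in> Ob \<Theta> \<Longrightarrow> obj_map (inv_functor \<Theta> \<Phi>) B = B"
  using bij_betw_inv_into_left[of "obj_map \<Phi>" "Ob \<Theta>" "Ob \<Theta>" B] automorphism obj_map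
  unfolding inv_functor_def automorphism_def by simp

text \<open>The formula \<open>\<Phi>\<^sup>-\<^sup>1 \<mu> = (s B)\<^sup>-\<^sup>1 \<circ> \<mu> \<circ> s A\<close>, written without inverse maps.\<close>

lemma arr_map_inv:
  assumes A: "A \<in> Ob \<Theta>" and B: "B \<in> Ob \<Theta>" and \<mu>: "\<mu> \<in> homs \<Theta> A B"
  defines "\<nu> \<equiv> arr_map (inv_functor \<Theta> \<Phi>) A B \<mu>"
  shows "\<nu> \<in> homs \<Theta> A B" and "a \<in> carrier A \<Longrightarrow> s B (\<nu> a) = \<mu> (s A a)"
proof -
  have "\<nu> = inv_into (homs \<Theta> A B) (arr_map \<Phi> A B) \<mu>"
    using obj_map_inv[OF A] obj_map_inv[OF B] unfolding \<nu>_def inv_functor_def by (simp add: Let_def)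
  then show \<nu>: "\<nu> \<in> homs \<Theta> A B" and "a \<in> carrier A \<Longrightarrow> s B (\<nu> a) = \<mu> (s A a)"
    using bij_betw_inv_into_right[OF bij_arr_map[OF A B] \<mu>]
      bij_betwE[OF bij_betw_inv_into[OF bij_arr_map[OF A B]]] \<mu> arr_map_s[OF A B, of \<nu> a]
    by auto
qed

lemma inv_functor_provides:
  assumes H: "in_variety \<Theta> H"
  shows "provides_automorphic_equivalence \<Theta> (inv_functor \<Theta> \<Phi>) H (star H)"
  unfolding provides_automorphic_equivalence_def
proof (intro conjI exI[of _ "\<lambda>B. pullback B (s B)"] ballI)
  show "automorphism \<Theta> (inv_functor \<Theta> \<Phi>)" by (rule automorphism_inv_functor[OF var automorphism])
  show "in_variety \<Theta> H" by fact
  show "in_variety \<Theta> (star H)" by (rule in_variety_star[OF H])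
  have bij: "bij_betw (pullback B (s B)) (Cl \<Theta> H B) (Cl \<Theta> (star H) B)" if "B \<in> Ob \<Theta>" for B
    by (rule bij_betw_pullback_Cl[OF bij_s[OF that] homs_star[OF that H]])
  then show "bij_betw (pullback B (s B)) (Cl \<Theta> H B) (Cl \<Theta> (star H) (obj_map (inv_functor \<Theta> \<Phi>) B))"
    if "B \<in> Ob \<Theta>" for B
    using that obj_map_inv by simp
  fix A B \<mu>1 \<mu>2 T
  assume AB: "A \<in> Ob \<Theta>" "B \<in> Ob \<Theta>" and \<mu>: "\<mu>1 \<in> homs \<Theta> A B" "\<mu>2 \<in> homs \<Theta> A B" and T: "T \<in> Cl \<Theta> H B"
  let ?\<nu> = "arr_map (inv_functor \<Theta> \<Phi>) A B"
  let ?T = "pullback B (s B) T"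
  have T': "?T \<in> Cl \<Theta> (star H) B" using bij_betwE[OF bij[OF AB(2)]] T by blast
  note \<nu> = arr_map_inv[OF AB \<mu>(1)] arr_map_inv[OF AB \<mu>(2)]
  have "compose (carrier A) (nat_epi B ?T) (?\<nu> \<mu>1) = compose (carrier A) (nat_epi B ?T) (?\<nu> \<mu>2)
      \<longleftrightarrow> (\<forall>a\<in>carrier A. (?\<nu> \<mu>1 a, ?\<nu> \<mu>2 a) \<in> ?T)"
    by (rule nat_epi_compose_eq_iff[OF Cl_equiv[OF T'] \<nu>(1,3)])
  also have "\<dots> \<longleftrightarrow> (\<forall>a\<in>carrier A. (\<mu>1 (s A a), \<mu>2 (s A a)) \<in> T)"
    using \<nu>(2,4) homs_carrier[OF \<nu>(1)] homs_carrier[OF \<nu>(3)] by (simp add: pullback_def)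
  also have "\<dots> \<longleftrightarrow> (\<forall>a\<in>carrier A. (\<mu>1 a, \<mu>2 a) \<in> T)"
    using bij_betw_ball[OF bij_s[OF AB(1)], of "\<lambda>a. (\<mu>1 a, \<mu>2 a) \<in> T"] by simp
  also have "\<dots> \<longleftrightarrow> compose (carrier A) (nat_epi B T) \<mu>1 = compose (carrier A) (nat_epi B T) \<mu>2"
    by (rule nat_epi_compose_eq_iff[OF Cl_equiv[OF T] \<mu>, symmetric])
  finally show "compose (carrier A) (nat_epi B T) \<mu>1 = compose (carrier A) (nat_epi B T) \<mu>2 \<longleftrightarrow>
      compose (carrier (obj_map (inv_functor \<Theta> \<Phi>) A))
        (nat_epi (obj_map (inv_functor \<Theta> \<Phi>) B) ?T) (?\<nu> \<mu>1) =
      compose (carrier (obj_map (inv_functor \<Theta> \<Phi>) A))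
        (nat_epi (obj_map (inv_functor \<Theta> \<Phi>) B) ?T) (?\<nu> \<mu>2)"
    unfolding obj_map_inv[OF AB(1)] obj_map_inv[OF AB(2)] by simp
qed

end

theorem theorem4p1:
  fixes \<Theta> :: "'f var_data"
    and \<Phi> :: "'f endofunctor"
    and s :: "('f, 'f trm set) algebra \<Rightarrow> 'f trm set \<Rightarrow> 'f trm set"
    and w :: "'f \<Rightarrow> 'f trm set"
    and H :: "('f, 'h) algebra"
  assumes "variety \<Theta>"
    and "strongly_stable \<Theta> \<Phi>"
    and "A2 \<Theta> \<Phi> s" and "A3 \<Theta> s"
    and "\<And>\<omega>. \<omega> \<in> symbols \<Theta> \<Longrightarrow> w \<omega> = s (A_omega \<Theta> \<omega>) (op_word \<Theta> \<omega>)"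
    and "in_variety \<Theta> H"
  shows "provides_automorphic_equivalence \<Theta> (inv_functor \<Theta> \<Phi>) H (induced_algebra \<Theta> w H)"
proof -
  interpret stable_system \<Theta> \<Phi> s w
    using assms(1-5) by unfold_locales
  show ?thesis by (rule inv_functor_provides[OF assms(6)])
qed

end
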